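(* Let $G=(V,E)$ be a graph with edge coloring $\mathcal{C}:E\to C$ and let $S\subseteq V$ be a set of terminals. Suppose a Tutte set $A$ exists. Let $s\in S$ be a terminal, let $H$ be a connected component of $G-A$ containing the vertex $t$ but not $s$, and assume that there is no mismatched edge with an endpoint in $H$. Then there is no alternating $s$-$t$ trail in $G$. In particular (whenever a Tutte set exists), there is no alternating trail connecting distinct terminals, i.e. no alternating $s$-$s'$ trail with $s,s'\in S$, $s\neq s'$.
   Context: Graphs are finite and undirected; parallel edges are allowed, loops are not. Colors come from a set $C$ with $\#C\ge 2$. A $v_0$-$v_m$ walk is a sequence $W=(v_0,e_1,v_1,\ldots,e_m,v_m)$, $m\ge 0$, where each $e_j\in E$ has endpoints $v_{j-1},v_j$ (vertices and edges may repeat). It is a trail when $e_1,\ldots,e_m$ are distinct. It is closed when $v_0=v_m$. It is internally alternating when $\mathcal{C}(e_j)\ne\mathcal{C}(e_{j+1})$ for $j=1,\ldots,m-1$, and alternating when in addition, if $W$ is closed, $\mathcal{C}(e_m)\ne \mathcal{C}(e_1)$ (so for $v_0\neq v_m$ the two notions coincide). Tutte set: a subset $A\subseteq V-S$ is a Tutte set (with respect to $G,\mathcal{C},S$) when (i) each component of $G-A$ contains at most one terminal; and (ii) $A$ can be written as a disjoint union $A=\dot\bigcup_{c\in C}A(c)$ (empty blocks allowed) such that conditions (a), (b), (c) below hold. A vertex $u\in A$ has color $c$ if $u\in A(c)$. An edge $e$ is mismatched if either $e$ connects some $u\in A$ with some $v\in V-A$ and $\mathcal{C}(e)$ differs from the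 color of $u$, or $e$ connects two vertices $u,v\in A$ and $\mathcal{C}(e)$ differs from both the color of $u$ and the color of $v$. Conditions: (a) if $H$ is a component of $G-A$ containing a terminal, then there is no mismatched edge with an endpoint in $H$; (b) if $H$ is a component of $G-A$ containing no terminal, then there is at most one mismatched edge with an endpoint in $H$; (c) there are no mismatched edges with both endpoints in $A$. "A Tutte set $A$" comes with a fixed such decomposition, and mismatched edges are with respect to it. *)

theory Defs
  imports Main "HOL-Library.Disjoint_Sets"
begin

record ('v, 'e) graph =
  verts :: "'v set"
  edges :: "'e set"
  ends :: "'e \<Rightarrow> 'v set"

text \<open>Edges are named objects, so parallel edges are allowed; the requirement of exactly two
  endpoints excludes loops.\<close>

definition finite_loopless_graph :: "('v, 'e) graph \<Rightarrow> bool" where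
  "finite_loopless_graph G \<longleftrightarrow>
     finite (verts G) \<and> finite (edges G) \<and>
     (\<forall>e \<in> edges G. ends G e \<subseteq> verts G \<and> card (ends G e) = 2)"

text \<open>The set of colors may be infinite, hence \<open>card K \<ge> 2\<close> would be too strong.\<close>

definition edge_coloring :: "('v, 'e) graph \<Rightarrow> 'c set \<Rightarrow> ('e \<Rightarrow> 'c) \<Rightarrow> bool" where
  "edge_coloring G K col \<longleftrightarrow>
     (\<exists>c \<in> K. \<exists>d \<in> K. c \<noteq> d) \<and> (\<forall>e \<in> edges G. col e \<in> K)"

text \<open>The walk \<open>(v\<^sub>0, e\<^sub>1, v\<^sub>1, \<dots>, e\<^sub>m, v\<^sub>m)\<close> is represented by
  \<open>vs = [v\<^sub>0, \<dots>, v\<^sub>m]\<close> and \<open>es = [e\<^sub>1, \<dots>, e\<^sub>m]\<close>; list positions start at 0,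
  so \<open>es ! j\<close> is \<open>e\<close> with index \<open>j + 1\<close>.\<close>

definition walk :: "('v, 'e) graph \<Rightarrow> 'v \<Rightarrow> 'v list \<Rightarrow> 'e list \<Rightarrow> 'v \<Rightarrow> bool" where
  "walk G u vs es v \<longleftrightarrow>
     length vs = length es + 1 \<and> set vs \<subseteq> verts G \<and> set es \<subseteq> edges G \<and>
     hd vs = u \<and> last vs = v \<and>
     (\<forall>j < length es. ends G (es ! j) = {vs ! j, vs ! (j + 1)})"

definition trail :: "('v, 'e) graph \<Rightarrow> 'v \<Rightarrow> 'v list \<Rightarrow> 'e list \<Rightarrow> 'v \<Rightarrow> bool" where
  "trail G u vs es v \<longleftrightarrow> walk G u vs es v \<and> distinct es"

definition internally_alternating :: "('e \<Rightarrow> 'c) \<Rightarrow> 'e list \<Rightarrow> bool" where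
  "internally_alternating col es \<longleftrightarrow>
     (\<forall>j. j + 1 < length es \<longrightarrow> col (es ! j) \<noteq> col (es ! (j + 1)))"

definition alternating :: "('e \<Rightarrow> 'c) \<Rightarrow> 'v list \<Rightarrow> 'e list \<Rightarrow> bool" where
  "alternating col vs es \<longleftrightarrow>
     internally_alternating col es \<and>
     (hd vs = last vs \<and> es \<noteq> [] \<longrightarrow> col (last es) \<noteq> col (hd es))"

definition alternating_trail ::
  "('v, 'e) graph \<Rightarrow> ('e \<Rightarrow> 'c) \<Rightarrow> 'v \<Rightarrow> 'v list \<Rightarrow> 'e list \<Rightarrow> 'v \<Rightarrow> bool" where
  "alternating_trail G col u vs es v \<longleftrightarrow> trail G u vs es v \<and> alternating col vs es"

definition delete_verts :: "('v, 'e) graph \<Rightarrow> 'v set \<Rightarrow> ('v, 'e) graph" where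
  "delete_verts G A =
     \<lparr>verts = verts G - A, edges = {e \<in> edges G. ends G e \<inter> A = {}}, ends = ends G\<rparr>"

text \<open>Components are represented by their vertex sets, the classes of the relation
  ``joined by a walk''.\<close>

definition components :: "('v, 'e) graph \<Rightarrow> 'v set set" where
  "components G = verts G // {(u, v). \<exists>vs es. walk G u vs es v}"

text \<open>Throughout, \<open>B c\<close> is the block of vertices of color \<open>c\<close>.\<close>

definition has_color :: "'c set \<Rightarrow> ('c \<Rightarrow> 'v set) \<Rightarrow> 'v \<Rightarrow> 'c \<Rightarrow> bool" where
  "has_color K B u c \<longleftrightarrow> c \<in> K \<and> u \<in> B c"

definition mismatched ::
  "('v, 'e) graph \<Rightarrow> 'c set \<Rightarrow> ('e \<Rightarrow> 'c) \<Rightarrow> 'v set \<Rightarrow> ('c \<Rightarrow> 'v set) \<Rightarrow> 'e \<Rightarrow> bool" where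
  "mismatched G K col A B e \<longleftrightarrow> e \<in> edges G \<and>
     ((\<exists>u v c. ends G e = {u, v} \<and> u \<in> A \<and> v \<in> verts G - A \<and>
               has_color K B u c \<and> col e \<noteq> c) \<or>
      (\<exists>u v c d. ends G e = {u, v} \<and> u \<in> A \<and> v \<in> A \<and>
               has_color K B u c \<and> has_color K B v d \<and> col e \<noteq> c \<and> col e \<noteq> d))"

definition mismatched_edges_at ::
  "('v, 'e) graph \<Rightarrow> 'c set \<Rightarrow> ('e \<Rightarrow> 'c) \<Rightarrow> 'v set \<Rightarrow> ('c \<Rightarrow> 'v set) \<Rightarrow> 'v set \<Rightarrow> 'e set" where
  "mismatched_edges_at G K col A B H =
     {e. mismatched G K col A B e \<and> ends G e \<inter> H \<noteq> {}}"

text \<open>The decomposition \<open>B\<close> of \<open>A\<close> is part of the data. For finite graphs both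
  cardinality bounds below concern finite sets.\<close>

definition tutte_set ::
  "('v, 'e) graph \<Rightarrow> 'c set \<Rightarrow> ('e \<Rightarrow> 'c) \<Rightarrow> 'v set \<Rightarrow> 'v set \<Rightarrow> ('c \<Rightarrow> 'v set) \<Rightarrow> bool" where
  "tutte_set G K col S A B \<longleftrightarrow>
     A \<subseteq> verts G - S \<and>
     (\<forall>H \<in> components (delete_verts G A). card (H \<inter> S) \<le> 1) \<and>
     disjoint_family_on B K \<and> A = (\<Union>c\<in>K. B c) \<and>
     (\<forall>H \<in> components (delete_verts G A).
        H \<inter> S \<noteq> {} \<longrightarrow> mismatched_edges_at G K col A B H = {}) \<and>
     (\<forall>H \<in> components (delete_verts G A).
        H \<inter> S = {} \<longrightarrow> card (mismatched_edges_at G K col A B H) \<le> 1) \<and>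
     \<not> (\<exists>e. mismatched G K col A B e \<and> ends G e \<subseteq> A)"

end

theory Submission
  imports Defs
begin

text \<open>Follow an alternating trail starting at a terminal \<open>s\<close>. Whenever it is at a vertex of \<open>A\<close>,
  the edge it arrived by has the color of that vertex, so the next edge does not have it: the trail
  can enter a component of \<open>G - A\<close> only through a mismatched edge. The component of \<open>s\<close> has no
  mismatched edge, and any other component has at most one, which is used up on entering;
  hence every edge by which the trail returns to \<open>A\<close> is matched and the invariant persists. Thus a
  component reached by the trail contains \<open>s\<close> or meets a mismatched edge.\<close>

section \<open>Connectivity and components\<close>

definition joined :: "('v, 'e) graph \<Rightarrow> ('v \<times> 'v) set" where
  "joined G = {(u, v). \<exists>vs es. walk G u vs es v}"

text \<open>Single steps along an edge. Their reflexive transitive closure describes connectivity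
  without concatenating or reversing the two lists of a walk.\<close>

definition adjacent :: "('v, 'e) graph \<Rightarrow> ('v \<times> 'v) set" where
  "adjacent G = {(u, v). u \<in> verts G \<and> v \<in> verts G \<and> (\<exists>e \<in> edges G. ends G e = {u, v})}"

lemma walk_Nil: "walk G u [u] [] u" if "u \<in> verts G"
  using that by (simp add: walk_def)

lemma walk_Cons:
  assumes "u \<in> verts G" "e \<in> edges G" "ends G e = {u, v}" "walk G v vs es w"
  shows "walk G u (u # vs) (e # es) w"
proof -
  have ne: "vs \<noteq> []" and hd: "hd vs = v"
    using assms by (auto simp: walk_def)
  have "ends G ((e # es) ! j) = {(u # vs) ! j, (u # vs) ! (j + 1)}" if "j < length (e # es)" for j
    using that assms ne hd by (cases j) (auto simp: walk_def hd_conv_nth)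
  then show ?thesis
    using assms ne by (auto simp: walk_def)
qed

lemma walk_imp_rtrancl:
  assumes w: "walk G u vs es v" and j: "j \<le> length es"
  shows "(u, vs ! j) \<in> (adjacent G)\<^sup>*"
  using j
proof (induction j)
  case 0
  have "vs ! 0 = u"
    using w by (cases vs) (auto simp: walk_def)
  then show ?case by simp
next
  case (Suc j)
  then have "(vs ! j, vs ! Suc j) \<in> adjacent G"
    using w by (auto simp: walk_def adjacent_def intro!: bexI[of _ "es ! j"])
  with Suc show ?case by (meson Suc_leD rtrancl.rtrancl_into_rtrancl)
qed

text \<open>The membership conditions are needed because the closure is reflexive on the whole type,
  while even an empty walk must lie in \<open>verts G\<close>.\<close>

lemma joined_iff_rtrancl:
  "(u, v) \<in> joined G \<longleftrightarrow> u \<in> verts G \<and> v \<in> verts G \<and> (u, v) \<in> (adjacent G)\<^sup>*"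
proof
  assume "(u, v) \<in> joined G"
  then obtain vs es where w: "walk G u vs es v"
    by (auto simp: joined_def)
  then have ne: "vs \<noteq> []" "vs ! length es = v"
    using last_conv_nth[of vs] by (cases vs; auto simp: walk_def)+
  with w walk_imp_rtrancl[OF w order_refl] show "u \<in> verts G \<and> v \<in> verts G \<and> (u, v) \<in> (adjacent G)\<^sup>*"
    by (auto simp: walk_def)
next
  assume *: "u \<in> verts G \<and> v \<in> verts G \<and> (u, v) \<in> (adjacent G)\<^sup>*"
  then have "(u, v) \<in> (adjacent G)\<^sup>*" by simp
  then show "(u, v) \<in> joined G"
  proof (induction rule: converse_rtrancl_induct)
    case base
    with * show ?case by (auto simp: joined_def intro: walk_Nil)
  next
    case (step y z)
    then show ?case by (auto simp: joined_def adjacent_def intro: walk_Cons)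
  qed
qed

lemma equiv_joined: "equiv (verts G) (joined G)"
proof (rule equivI)
  show "joined G \<subseteq> verts G \<times> verts G"
    by (auto simp: joined_iff_rtrancl)
  show "refl_on (verts G) (joined G)"
    by (auto simp: refl_on_def joined_iff_rtrancl)
  \<comment> \<open>Endpoints form an unordered set, so every step can be reversed.\<close>
  have "sym (adjacent G)"
    by (auto simp: sym_def adjacent_def insert_commute)
  then have "sym ((adjacent G)\<^sup>*)"
    by (rule sym_rtrancl)
  then show "sym (joined G)"
    by (auto simp: sym_def joined_iff_rtrancl)
  show "trans (joined G)"
    by (auto simp: trans_def joined_iff_rtrancl intro: rtrancl_trans)
qed

lemma components_eq: "components G = verts G // joined G"
  by (simp add: components_def joined_def)

lemma component_in: "v \<in> verts G \<Longrightarrow> joined G `` {v} \<in> components G"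
  by (simp add: components_eq quotientI)

lemma component_self: "v \<in> verts G \<Longrightarrow> v \<in> joined G `` {v}"
  by (rule equiv_class_self[OF equiv_joined])

lemma component_eqI:
  assumes "H \<in> components G" "v \<in> H"
  shows "H = joined G `` {v}"
proof -
  from assms(1) obtain x where "H = joined G `` {x}"
    by (auto simp: components_eq elim: quotientE)
  with assms(2) show ?thesis
    using equiv_class_eq[OF equiv_joined] by fastforce
qed

lemma component_subset: "H \<in> components G \<Longrightarrow> H \<subseteq> verts G"
  by (auto simp: components_eq joined_iff_rtrancl elim!: quotientE)

lemma component_adjacent: "(u, v) \<in> adjacent G \<Longrightarrow> joined G `` {u} = joined G `` {v}"
  by (rule equiv_class_eq[OF equiv_joined])
    (auto simp: joined_iff_rtrancl adjacent_def)

section \<open>Tutte sets and the invariant along a trail\<close>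

lemma tutte_set_color_of: "tutte_set G K col S A B \<Longrightarrow> u \<in> A \<Longrightarrow> \<exists>c. has_color K B u c"
  by (auto simp: tutte_set_def has_color_def)

lemma tutte_set_no_mismatched_inside:
  "tutte_set G K col S A B \<Longrightarrow> mismatched G K col A B e \<Longrightarrow> \<not> ends G e \<subseteq> A"
  by (auto simp: tutte_set_def)

text \<open>Conditions (a) and (b) together bound the number of mismatched edges by one at every
  component, with or without a terminal.\<close>

lemma mismatched_edges_at_unique:
  assumes "finite (edges G)" "tutte_set G K col S A B" "H \<in> components (delete_verts G A)"
    and "e \<in> mismatched_edges_at G K col A B H" "f \<in> mismatched_edges_at G K col A B H"
  shows "e = f"
proof -
  \<comment> \<open>Finiteness gives the bound its meaning, since \<open>card\<close> of an infinite
    set is 0.\<close>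
  have "finite (mismatched_edges_at G K col A B H)"
    by (rule finite_subset[OF _ assms(1)]) (auto simp: mismatched_edges_at_def mismatched_def)
  moreover have "card (mismatched_edges_at G K col A B H) \<le> 1"
    using assms(2-4) by (auto simp: tutte_set_def)
  ultimately show ?thesis
    using assms(4,5) by (auto simp: card_le_Suc0_iff_eq)
qed

text \<open>The edge \<open>es ! (j - 1)\<close> is the one arriving at \<open>vs ! j\<close>; the
  guard \<open>0 < j\<close> rules out truncated subtraction. The index \<open>i < j\<close> records
  that the single mismatched edge allowed at the current component is already spent.\<close>

lemma alternating_trail_invariant:
  fixes G :: "('v, 'e) graph" and A :: "'v set"
  defines "comp_of \<equiv> \<lambda>v. joined (delete_verts G A) `` {v}"
  assumes fin: "finite (edges G)"
    and T: "tutte_set G K col S A B"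
    and s: "s \<in> S" "s \<in> verts G"
    and tr: "trail G s vs es t" and alt: "internally_alternating col es"
    and j: "j \<le> length es"
  shows "(vs ! j \<in> A \<longrightarrow> 0 < j \<and> has_color K B (vs ! j) (col (es ! (j - 1)))) \<and>
    (vs ! j \<notin> A \<longrightarrow> s \<in> comp_of (vs ! j) \<or>
      (\<exists>i < j. es ! i \<in> mismatched_edges_at G K col A B (comp_of (vs ! j))))"
  using j
proof (induction j)
  case 0
  have "vs ! 0 = s"
    using tr by (cases vs) (auto simp: trail_def walk_def)
  moreover have "s \<notin> A"
    using T s by (auto simp: tutte_set_def)
  ultimately show ?case
    using s component_self[of s "delete_verts G A"] by (auto simp: comp_of_def delete_verts_def)
next
  case (Suc j)
  define e u v where "e = es ! j" and "u = vs ! j" and "v = vs ! Suc j"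
  have e: "e \<in> edges G" and uv: "u \<in> verts G" "v \<in> verts G" and ends: "ends G e = {u, v}"
    using tr Suc.prems by (auto simp: trail_def walk_def e_def u_def v_def)
  note IH = Suc.IH[OF Suc_leD[OF Suc.prems], folded u_def]
  show ?case
  proof (cases "u \<in> A")
    case True
    define c where "c = col (es ! (j - 1))"
    have c: "0 < j" "has_color K B u c"
      using IH True by (auto simp: c_def)
    \<comment> \<open>Indices are shaped to instantiate \<open>internally_alternating\<close> at
      \<open>j - 1\<close>; as \<open>0 < j\<close>, the second edge is \<open>e\<close>.\<close>
    have "j - 1 + 1 < length es"
      using Suc.prems c(1) by simp
    then have "col (es ! (j - 1)) \<noteq> col (es ! (j - 1 + 1))"
      using alt unfolding internally_alternating_def by blast
    then have ne: "col e \<noteq> c"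
      using c(1) by (simp add: c_def e_def)
    show ?thesis
    proof (cases "v \<in> A")
      case vA: True
      then obtain d where d: "has_color K B v d"
        using tutte_set_color_of[OF T] by blast
      \<comment> \<open>Since \<open>e\<close> avoids the color of \<open>u\<close>, condition (c)
        forces it to have the color of \<open>v\<close>.\<close>
      have "col e = d"
      proof (rule ccontr)
        assume "col e \<noteq> d"
        then have "mismatched G K col A B e"
          using e ends True vA c(2) d ne unfolding mismatched_def by blast
        with tutte_set_no_mismatched_inside[OF T, of e] ends True vA show False
          by simp
      qed
      with d vA show ?thesis
        by (simp add: e_def v_def)
    next
      case False
      \<comment> \<open>Entering a component from \<open>A\<close> uses a mismatched edge;
        \<open>e\<close> itself is the witness, with \<open>i = j\<close> below
        \<open>Suc j\<close>.\<close>
      have "mismatched G K col A B e"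
        using e ends True False uv c(2) ne unfolding mismatched_def by blast
      moreover have "v \<in> comp_of v"
        using component_self[of v "delete_verts G A"] uv False
        by (simp add: comp_of_def delete_verts_def)
      ultimately have "e \<in> mismatched_edges_at G K col A B (comp_of v)"
        using ends by (auto simp: mismatched_edges_at_def)
      with False show ?thesis
        by (auto simp: e_def v_def)
    qed
  next
    case False
    have u: "u \<in> verts (delete_verts G A)"
      using uv False by (simp add: delete_verts_def)
    have comp_u: "comp_of u \<in> components (delete_verts G A)" "u \<in> comp_of u"
      using component_in[OF u] component_self[OF u] by (auto simp: comp_of_def)
    show ?thesis
    proof (cases "v \<in> A")
      case vA: True
      then obtain d where d: "has_color K B v d"
        using tutte_set_color_of[OF T] by blast
      have "col e = d"
      proof (rule ccontr)
        assume "col e \<noteq> d"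
        moreover have "ends G e = {v, u}"
          using ends by auto
        ultimately have "mismatched G K col A B e"
          using e False vA d uv unfolding mismatched_def by blast
        then have mm: "e \<in> mismatched_edges_at G K col A B (comp_of u)"
          using ends comp_u(2) by (auto simp: mismatched_edges_at_def)
        \<comment> \<open>By (a), a component with a mismatched edge contains no terminal, so the
          invariant must supply an earlier mismatched edge.\<close>
        then have "s \<notin> comp_of u"
          using T comp_u(1) s(1) by (auto simp: tutte_set_def)
        then obtain i where i: "i < j" "es ! i \<in> mismatched_edges_at G K col A B (comp_of u)"
          using IH False by blast
        \<comment> \<open>Leaving by a mismatched edge would repeat the edge of entry, which a trail
          cannot do.\<close>
        then have "es ! i = es ! j"
          using mismatched_edges_at_unique[OF fin T comp_u(1) _ mm] by (simp add: e_def)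
        moreover have "distinct es"
          using tr by (simp add: trail_def)
        ultimately show False
          using i(1) Suc.prems by (simp add: nth_eq_iff_index_eq)
      qed
      with d vA show ?thesis
        by (simp add: e_def v_def)
    next
      case vA: False
      have "(u, v) \<in> adjacent (delete_verts G A)"
        using e ends uv False vA by (auto simp: adjacent_def delete_verts_def)
      \<comment> \<open>The step stays within one component, so the invariant carries over with a
        larger index bound.\<close>
      then have "comp_of u = comp_of v"
        unfolding comp_of_def by (rule component_adjacent)
      with IH False vA show ?thesis
        unfolding v_def[symmetric] by (metis less_SucI)
    qed
  qed
qed

section \<open>Excluding alternating trails\<close>

lemma no_alternating_trail_into_matched_component:
  assumes "finite (edges G)" "tutte_set G K col S A B" "s \<in> S" "s \<in> verts G"
    and H: "H \<in> components (delete_verts G A)" "t \<in> H" "s \<notin> H"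
    and empty: "mismatched_edges_at G K col A B H = {}"
  shows "\<not> alternating_trail G col s vs es t"
proof
  assume "alternating_trail G col s vs es t"
  then have tr: "trail G s vs es t" and alt: "internally_alternating col es"
    by (auto simp: alternating_trail_def alternating_def)
  have t: "vs ! length es = t"
    using tr last_conv_nth[of vs] by (cases vs) (auto simp: trail_def walk_def)
  have "t \<notin> A"
    using component_subset[OF H(1)] H(2) by (auto simp: delete_verts_def)
  \<comment> \<open>At the last index the invariant puts \<open>s\<close> or a mismatched edge at
    the class of \<open>t\<close>, which \<open>component_eqI\<close> identifies with
    \<open>H\<close>.\<close>
  with alternating_trail_invariant[OF assms(1-4) tr alt order_refl] t
    component_eqI[OF H(1,2)] H(3) empty
  show False
    by auto
qed

theorem theorem2p2:
  fixes G :: "('v, 'e) graph" and K :: "'c set" and col :: "'e \<Rightarrow> 'c"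
    and S A :: "'v set" and B :: "'c \<Rightarrow> 'v set"
  assumes "finite_loopless_graph G"
    and "edge_coloring G K col"
    and "S \<subseteq> verts G"
    and "tutte_set G K col S A B"
  shows "(\<forall>s t H. s \<in> S \<and> H \<in> components (delete_verts G A) \<and> t \<in> H \<and> s \<notin> H \<and>
            mismatched_edges_at G K col A B H = {}
            \<longrightarrow> \<not> (\<exists>vs es. alternating_trail G col s vs es t)) \<and>
         (\<forall>s s'. s \<in> S \<and> s' \<in> S \<and> s \<noteq> s'
            \<longrightarrow> \<not> (\<exists>vs es. alternating_trail G col s vs es s'))"
proof (intro conjI allI impI)
  have fin: "finite (edges G)" "finite (verts G)"
    using assms(1) by (auto simp: finite_loopless_graph_def)
  note main = no_alternating_trail_into_matched_component[OF fin(1) assms(4)]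
  fix s t H
  assume "s \<in> S \<and> H \<in> components (delete_verts G A) \<and> t \<in> H \<and> s \<notin> H \<and>
    mismatched_edges_at G K col A B H = {}"
  with main assms(3) show "\<not> (\<exists>vs es. alternating_trail G col s vs es t)"
    by blast
next
  have fin: "finite (edges G)" "finite (verts G)"
    using assms(1) by (auto simp: finite_loopless_graph_def)
  note main = no_alternating_trail_into_matched_component[OF fin(1) assms(4)]
  fix s s'
  assume s: "s \<in> S \<and> s' \<in> S \<and> s \<noteq> s'"
  \<comment> \<open>The component of \<open>s'\<close> reduces the second claim to the first: (i)
    keeps \<open>s\<close> out of it and (a) excludes mismatched edges.\<close>
  define H where "H = joined (delete_verts G A) `` {s'}"
  have "s' \<in> verts (delete_verts G A)"
    using s assms(3,4) by (auto simp: tutte_set_def delete_verts_def)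
  then have H: "H \<in> components (delete_verts G A)" "s' \<in> H"
    unfolding H_def by (rule component_in, rule component_self)
  have "finite (H \<inter> S)"
    using fin(2) assms(3) by (meson finite_Int finite_subset)
  moreover have "card (H \<inter> S) \<le> 1"
    using assms(4) H(1) by (auto simp: tutte_set_def)
  ultimately have "s \<notin> H"
    using s H(2) by (auto simp: card_le_Suc0_iff_eq)
  moreover have "mismatched_edges_at G K col A B H = {}"
    using assms(4) H s unfolding tutte_set_def by blast
  ultimately show "\<not> (\<exists>vs es. alternating_trail G col s vs es s')"
    using main H s assms(3) by blast
qed

end
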